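(* Let $\omega:[0,1]\to\mathbb{R}_{+}$ be a strictly increasing modulus of continuity. Then for each $f\in \mathrm{Diff}^{\omega}_0[0,1]$ with $\gamma(f)=1$ there is a constant $C(f)$, not depending on $n$, such that $$\log \Gamma_n(f)\le \log\frac{n}{\omega^{-1}\left(\frac{2}{n}\right)}+C(f)\, n\,\omega\left(\frac1n\right)$$ for all $n\in\mathbb{N}$ such that $\frac2n$ lies in the range of $\omega$, where $\omega^{-1}$ denotes the inverse function of $\omega$.
   Context: $\mathrm{Diff}_0[0,1]$ is the group of all $C^1$-smooth diffeomorphisms of $[0,1]$ fixing the end points $0$ and $1$. For $f\in\mathrm{Diff}_0[0,1]$ and $n\in\mathbb{N}$, the growth sequence is $\Gamma_n(f)=\max\{\|(f^n)'\|_\infty,\|(f^{-n})'\|_\infty\}$, where $f^n$ is the $n$-th iterate and $\|\cdot\|_\infty$ is the uniform norm on $[0,1]$; and $\gamma(f)=\lim_{n\to\infty}\sqrt[n]{\Gamma_n(f)}$ (the limit exists by submultiplicativity). A modulus of continuity is a non-decreasing continuous function $\omega:[0,1]\to\mathbb{R}_+=[0,\infty)$ with $\omega(0)=0$ and $\omega(\delta_1+\delta_2)\le\omega(\delta_1)+\omega(\delta_2)$ whenever $\delta_1,\delta_2,\delta_1+\delta_2\in[0,1]$. For a modulus of continuity $\omega$, $\mathrm{Diff}^{\omega}_0[0,1]$ is the set of $f\in\mathrm{Diff}_0[0,1]$ for which there is a constant $K(f)$ with $\omega_{f'}(\delta)\le K(f)\,\omega(\delta)$ for all $\delta\in[0,1]$,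 where $\omega_{f'}(\delta)=\max_{|x-y|\le\delta}|f'(x)-f'(y)|$. *)

theory Defs
  imports "HOL-Analysis.Analysis"
begin

(* Maps of [0,1] are total functions on the reals whose values outside [0,1] are irrelevant:
   derivatives are taken within [0,1] (hence one-sided at the end points), and inverses are
   inverses of the restriction to [0,1]. *)

abbreviation I01 :: "real set" where
  "I01 \<equiv> {0..1}"

definition D01 :: "(real \<Rightarrow> real) \<Rightarrow> real \<Rightarrow> real" where
  "D01 f x = vector_derivative f (at x within I01)"

definition C1_01 :: "(real \<Rightarrow> real) \<Rightarrow> bool" where
  "C1_01 f \<longleftrightarrow> (\<forall>x\<in>I01. f differentiable (at x within I01)) \<and> continuous_on I01 (D01 f)"

definition inv01 :: "(real \<Rightarrow> real) \<Rightarrow> real \<Rightarrow> real" where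
  "inv01 f = inv_into I01 f"

definition Diff0 :: "(real \<Rightarrow> real) set" where
  "Diff0 = {f. bij_betw f I01 I01 \<and> f 0 = 0 \<and> f 1 = 1 \<and> C1_01 f \<and> C1_01 (inv01 f)}"

(* A supremum of reals is only meaningful for bounded functions; it is applied below to
   functions that are continuous on [0,1] when f is in Diff0. *)
definition unif_norm :: "(real \<Rightarrow> real) \<Rightarrow> real" where
  "unif_norm g = (SUP x\<in>I01. \<bar>g x\<bar>)"

definition growth_seq :: "nat \<Rightarrow> (real \<Rightarrow> real) \<Rightarrow> real" where
  "growth_seq n f = max (unif_norm (D01 (f ^^ n))) (unif_norm (D01 (inv01 f ^^ n)))"

(* For f in Diff0 the limit exists because growth_seq is submultiplicative in n. *)
definition growth_rate :: "(real \<Rightarrow> real) \<Rightarrow> real" where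
  "growth_rate f = lim (\<lambda>n. root n (growth_seq n f))"

definition modulus_of_continuity :: "(real \<Rightarrow> real) \<Rightarrow> bool" where
  "modulus_of_continuity \<omega> \<longleftrightarrow>
     (\<forall>\<delta>\<in>I01. 0 \<le> \<omega> \<delta>) \<and> mono_on I01 \<omega> \<and> continuous_on I01 \<omega> \<and> \<omega> 0 = 0 \<and>
     (\<forall>\<delta>1\<in>I01. \<forall>\<delta>2\<in>I01. \<delta>1 + \<delta>2 \<in> I01 \<longrightarrow> \<omega> (\<delta>1 + \<delta>2) \<le> \<omega> \<delta>1 + \<omega> \<delta>2)"

(* For g continuous on [0,1] and \<delta> \<ge> 0 the supremum is attained by compactness. *)
definition osc_modulus :: "(real \<Rightarrow> real) \<Rightarrow> real \<Rightarrow> real" where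
  "osc_modulus g \<delta> = Sup {\<bar>g x - g y\<bar> | x y. x \<in> I01 \<and> y \<in> I01 \<and> \<bar>x - y\<bar> \<le> \<delta>}"

definition Diff0_mod :: "(real \<Rightarrow> real) \<Rightarrow> (real \<Rightarrow> real) set" where
  "Diff0_mod \<omega> = {f \<in> Diff0. \<exists>K::real. \<forall>\<delta>\<in>I01. osc_modulus (D01 f) \<delta> \<le> K * \<omega> \<delta>}"

end

theory Submission
  imports Defs
begin

text \<open>
  Let \<open>x\<^sub>k = f\<^sup>k(x)\<close> be an orbit that is not a fixed point, and let \<open>J\<^sub>k = \<bar>x\<^sub>k\<^sub>+\<^sub>1 - x\<^sub>k\<bar>\<close>
  be its step lengths.  The orbit is monotone, so the intervals between successive points do not
  overlap and \<open>\<Sum>J\<^sub>k \<le> 1\<close>.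

  \<^item> Distortion.  \<open>J\<^sub>k\<^sub>+\<^sub>1 / J\<^sub>k\<close> is the value of \<open>f'\<close> at some point at distance at most \<open>J\<^sub>k\<close>
    from \<open>x\<^sub>k\<close>.  Hence \<open>(f\<^sup>n)'(x) = \<Prod>f'(x\<^sub>k)\<close> is \<open>J\<^sub>n / J\<^sub>0\<close> up to a factor
    \<open>exp (c * \<Sum>\<omega>(J\<^sub>k))\<close>, and subadditivity of \<open>\<omega>\<close> together with \<open>\<Sum>J\<^sub>k \<le> 1\<close> gives
    \<open>\<Sum>\<omega>(J\<^sub>k) \<le> 2 n \<omega>(1/n)\<close> (lemma \<open>derivative_le_step_ratio\<close>).

  \<^item> Short steps.  The assumption \<open>\<gamma>(f) = 1\<close> enters by forcing \<open>f' = 1\<close> at every fixed point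
    (lemma \<open>derivative_at_fixed_point\<close>).  Put \<open>T = \<omega>\<^sup>-\<^sup>1(2/n)\<close>.  If \<open>J\<^sub>k \<le> T/n\<close> while
    \<open>f'\<close> exceeds \<open>1 + (4K+1)/n\<close> somewhere between \<open>x\<^sub>k\<close> and \<open>x\<^sub>k\<^sub>+\<^sub>1\<close>, then \<open>f' > 1 + 1/n\<close> on the
    whole \<open>T\<close>-neighbourhood of \<open>x\<^sub>k\<close>.  Going backwards along the orbit, the displacement \<open>f - id\<close>, at
    most \<open>T/n\<close> in modulus at \<open>x\<^sub>k\<close>, shrinks at a rate above \<open>1/n\<close>, so within a distance \<open>T\<close> it
    vanishes, at a fixed point where \<open>f' > 1\<close>: a contradiction.  Thus a step of length at most \<open>T/n\<close> is
    followed by a step that is longer by a factor of at most \<open>1 + (4K+1)/n\<close>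
    (lemma \<open>short_step_growth\<close>), and in \<open>n\<close> such steps the growth is bounded by a constant.  As soon
    as a step is longer than \<open>T/n\<close>, the trivial bound \<open>J\<^sub>n \<le> 1\<close> costs at most a factor \<open>n/T\<close>.

  Together \<open>(f\<^sup>n)'(x) \<le> (n/T) exp (C n \<omega>(1/n))\<close>, where the constant factor is absorbed by means of
  \<open>n \<omega>(1/n) \<ge> \<omega>(1) > 0\<close>.  The inverse of \<open>f\<close> satisfies the same hypotheses with another
  constant \<open>K\<close>, which bounds \<open>(f\<^sup>-\<^sup>n)'\<close>.
\<close>

section \<open>Moduli of continuity\<close>

lemma modulus_mono:
  assumes "modulus_of_continuity \<omega>" "0 \<le> d" "d \<le> e" "e \<le> 1"
  shows "\<omega> d \<le> \<omega> e"
  using assms unfolding modulus_of_continuity_def mono_on_def by auto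

lemma modulus_nonneg:
  assumes "modulus_of_continuity \<omega>" "0 \<le> d" "d \<le> 1"
  shows "0 \<le> \<omega> d"
  using assms unfolding modulus_of_continuity_def by auto

lemma modulus_le_multiple:
  assumes \<omega>: "modulus_of_continuity \<omega>" and s: "0 \<le> s" "s \<le> 1"
  shows "0 \<le> d \<Longrightarrow> d \<le> 1 \<Longrightarrow> d \<le> real N * s \<Longrightarrow> \<omega> d \<le> real N * \<omega> s"
proof (induction N arbitrary: d)
  case 0
  then have "d = 0" by simp
  then show ?case using \<omega> unfolding modulus_of_continuity_def by simp
next
  case (Suc N)
  show ?case
  proof (cases "d \<le> s")
    case True
    have "\<omega> d \<le> \<omega> s" using modulus_mono[OF \<omega>] Suc.prems s True by simp
    moreover have "0 \<le> \<omega> s" using modulus_nonneg[OF \<omega>] s by simp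
    ultimately show ?thesis by (simp add: algebra_simps add_increasing2)
  next
    case False
    have "\<omega> ((d - s) + s) \<le> \<omega> (d - s) + \<omega> s"
      using \<omega> s Suc.prems False unfolding modulus_of_continuity_def
      by (smt (verit) atLeastAtMost_iff)
    moreover have "\<omega> (d - s) \<le> real N * \<omega> s"
      by (rule Suc.IH) (use Suc.prems s False in \<open>auto simp: algebra_simps\<close>)
    ultimately show ?thesis by (simp add: algebra_simps)
  qed
qed

text \<open>Each \<open>J k\<close> is covered by \<open>\<lceil>n J k\<rceil>\<close> intervals of length \<open>1/n\<close>; the total number of
  these is at most \<open>n + n\<close>.\<close>

lemma sum_modulus_le:
  assumes \<omega>: "modulus_of_continuity \<omega>" and n: "n \<ge> (1::nat)"
    and J: "\<And>k. 0 \<le> J k" "\<And>k. J k \<le> 1" and sum: "(\<Sum>k<n. J k) \<le> 1"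
  shows "(\<Sum>k<n. \<omega> (J k)) \<le> 2 * real n * \<omega> (1 / real n)"
proof -
  have pos: "0 \<le> \<omega> (1 / real n)"
    using modulus_nonneg[OF \<omega>] n by simp
  have "\<omega> (J k) \<le> (real n * J k + 1) * \<omega> (1 / real n)" for k
  proof -
    let ?N = "nat \<lceil>real n * J k\<rceil>"
    have N: "real n * J k \<le> real ?N" "real ?N \<le> real n * J k + 1"
      using J(1)[of k] of_nat_nat[of "\<lceil>real n * J k\<rceil>"] by (simp_all add: of_nat_ceiling)
    have "\<omega> (J k) \<le> real ?N * \<omega> (1 / real n)"
      using modulus_le_multiple[OF \<omega>, of "1 / real n" "J k" ?N] J[of k] n N(1)
      by (simp add: field_simps)
    also have "\<dots> \<le> (real n * J k + 1) * \<omega> (1 / real n)"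
      using N(2) pos by (rule mult_right_mono)
    finally show ?thesis .
  qed
  then have "(\<Sum>k<n. \<omega> (J k)) \<le> (\<Sum>k<n. (real n * J k + 1) * \<omega> (1 / real n))"
    by (intro sum_mono)
  also have "\<dots> = real n * ((\<Sum>k<n. J k) + 1) * \<omega> (1 / real n)"
    by (simp add: sum_distrib_right[symmetric] sum.distrib sum_distrib_left[symmetric] algebra_simps)
  also have "\<dots> \<le> real n * 2 * \<omega> (1 / real n)"
    using sum pos by (intro mult_right_mono mult_left_mono) auto
  finally show ?thesis by (simp add: algebra_simps)
qed

section \<open>Two facts about real sequences\<close>

text \<open>If the start is above the threshold \<open>\<theta>\<close>, then \<open>J n \<le> 1\<close> suffices; otherwise the first step
  multiplies by at most \<open>q\<close> and the shifted sequence is shorter.\<close>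

lemma growth_below_threshold:
  fixes J :: "nat \<Rightarrow> real"
  assumes "0 < \<theta>" "1 \<le> q"
  shows "(\<And>k. 0 \<le> J k) \<Longrightarrow> (\<And>k. J k \<le> 1) \<Longrightarrow> \<theta> \<le> 1 \<Longrightarrow>
    (\<And>k. J k \<le> \<theta> \<Longrightarrow> J (Suc k) \<le> q * J k) \<Longrightarrow> \<theta> * J n \<le> q ^ n * J 0"
proof (induction n arbitrary: J)
  case 0
  then show ?case by (simp add: mult_left_le_one_le assms(1) less_imp_le)
next
  case (Suc n)
  show ?case
  proof (cases "J 0 \<le> \<theta>")
    case True
    have "\<theta> * J (Suc n) \<le> q ^ n * J (Suc 0)"
      using Suc.IH[of "\<lambda>k. J (Suc k)"] Suc.prems by simp
    also have "\<dots> \<le> q ^ n * (q * J 0)"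
      using Suc.prems(4)[OF True] assms(2) by (intro mult_left_mono) auto
    finally show ?thesis by (simp add: mult.assoc mult.left_commute)
  next
    case False
    have "\<theta> * J (Suc n) \<le> \<theta> * 1"
      using Suc.prems(2) assms(1) by (intro mult_left_mono) auto
    also have "\<dots> \<le> 1 * J 0" using False by simp
    also have "\<dots> \<le> q ^ Suc n * J 0"
      using Suc.prems(1) assms(2) one_le_power by (intro mult_right_mono) blast+
    finally show ?thesis .
  qed
qed

text \<open>Fekete's lemma: with \<open>m\<close> such that \<open>u m / m\<close> is nearly the infimum, writing
  \<open>n = q m + r\<close> with \<open>r < m\<close> gives \<open>u n / n \<le> u m / m + O(1/n)\<close>.\<close>

lemma fekete_convergent:
  fixes u :: "nat \<Rightarrow> real"
  assumes sub: "\<And>m n. u (m + n) \<le> u m + u n" and nonneg: "\<And>n. 0 \<le> u n"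
  shows "convergent (\<lambda>n. u n / real n)"
proof -
  define A where "A = (\<lambda>n. u n / real n) ` {1..}"
  define L where "L = Inf A"
  have bdd: "bdd_below A"
    unfolding A_def by (rule bdd_belowI[of _ 0]) (use nonneg in auto)
  have mult: "u (q * m + r) \<le> real q * u m + u r" for q m r
  proof (induction q)
    case (Suc q)
    have "u (m + (q * m + r)) \<le> u m + u (q * m + r)" by (rule sub)
    then show ?case using Suc by (simp add: algebra_simps)
  qed simp
  have "(\<lambda>n. u n / real n) \<longlonglongrightarrow> L"
  proof (rule LIMSEQ_I)
    fix \<epsilon> :: real assume \<epsilon>: "0 < \<epsilon>"
    have "\<exists>a\<in>A. a < L + \<epsilon> / 2"
      using \<epsilon> bdd cInf_less_iff[of A "L + \<epsilon> / 2"] unfolding L_def A_def by auto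
    then obtain m where m: "m \<ge> 1" "u m / real m < L + \<epsilon> / 2"
      unfolding A_def by auto
    define B where "B = (\<Sum>r<m. u r)"
    have B: "u r \<le> B" if "r < m" for r
      unfolding B_def using that nonneg by (intro member_le_sum) auto
    obtain N :: nat where N: "real N > 2 * B / \<epsilon>" using reals_Archimedean2 by blast
    show "\<exists>no. \<forall>n\<ge>no. norm (u n / real n - L) < \<epsilon>"
    proof (intro exI allI impI)
      fix n assume n: "n \<ge> Suc N"
      have n0: "real n > 0" using n by simp
      have "L \<le> u n / real n"
        unfolding L_def using bdd n by (intro cInf_lower) (auto simp: A_def)
      moreover have "u n / real n < L + \<epsilon>"
      proof -
        have "u n \<le> real (n div m) * u m + u (n mod m)"
          using mult[of "n div m" m "n mod m"] by simp
        also have "\<dots> \<le> real (n div m) * u m + B" using B[of "n mod m"] m by simp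
        also have "real (n div m) * u m = real (n div m * m) * (u m / real m)"
          using m by simp
        also have "\<dots> \<le> real n * (u m / real m)"
          using nonneg[of m] by (intro mult_right_mono) (auto simp del: of_nat_mult)
        finally have "u n / real n \<le> u m / real m + B / real n"
          using n0 by (simp add: field_simps)
        moreover have "B / real n < \<epsilon> / 2"
        proof -
          have "2 * B / \<epsilon> < real n" using N n by linarith
          then show ?thesis using \<epsilon> n0 by (simp add: field_simps)
        qed
        ultimately show ?thesis using m by linarith
      qed
      ultimately show "norm (u n / real n - L) < \<epsilon>" by (auto simp: abs_if)
    qed
  qed
  then show ?thesis by (rule convergentI)
qed

section \<open>Increasing diffeomorphisms of the interval and their orbits\<close>

text \<open>The derivative is a parameter so that the estimates apply alike to a diffeomorphism and to its
  inverse.\<close>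

locale interval_diffeo =
  fixes f f' :: "real \<Rightarrow> real"
  assumes f_0: "f 0 = 0" and f_1: "f 1 = 1"
    and deriv: "\<And>x. x \<in> I01 \<Longrightarrow> (f has_real_derivative f' x) (at x within I01)"
    and cont_deriv: "continuous_on I01 f'"
    and deriv_pos: "\<And>x. x \<in> I01 \<Longrightarrow> 0 < f' x"
begin

lemma mean_value:
  assumes "0 \<le> x" "x < y" "y \<le> 1"
  obtains \<xi> where "x < \<xi>" "\<xi> < y" "f y - f x = f' \<xi> * (y - x)"
proof -
  have "(f has_derivative (\<lambda>h. f' z * h)) (at z within {x..y})" if "x \<le> z" "z \<le> y" for z
    using deriv[of z] assms that has_derivative_subset[of f _ z I01 "{x..y}"]
    by (auto simp: has_field_derivative_def)
  from mvt_simple[of x y f "\<lambda>z h. f' z * h", OF assms(2) this] show ?thesis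
    using that by (auto simp: greaterThanLessThan_iff)
qed

lemma strict_increasing: "0 \<le> x \<Longrightarrow> x < y \<Longrightarrow> y \<le> 1 \<Longrightarrow> f x < f y"
proof -
  assume a: "0 \<le> x" "x < y" "y \<le> 1"
  obtain \<xi> where \<xi>: "x < \<xi>" "\<xi> < y" "f y - f x = f' \<xi> * (y - x)" using mean_value[OF a] .
  have "0 < f' \<xi>" using deriv_pos[of \<xi>] \<xi> a by simp
  then have "0 < f' \<xi> * (y - x)" using a by simp
  then show "f x < f y" using \<xi>(3) by simp
qed

lemma maps_to: "x \<in> I01 \<Longrightarrow> f x \<in> I01"
  using strict_increasing[of 0 x] strict_increasing[of x 1] f_0 f_1
  by (cases "x = 0"; cases "x = 1") auto

lemma iterate_maps_to: "x \<in> I01 \<Longrightarrow> (f ^^ n) x \<in> I01"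
  by (induction n) (auto dest: maps_to simp del: atLeastAtMost_iff)

lemma continuous: "continuous_on I01 f"
  using deriv by (intro DERIV_continuous_on) auto

lemma iterate_deriv:
  "x \<in> I01 \<Longrightarrow> ((f ^^ n) has_real_derivative (\<Prod>k<n. f' ((f ^^ k) x))) (at x within I01)"
proof (induction n)
  case 0
  then show ?case by (simp add: id_def)
next
  case (Suc n)
  have "(f has_real_derivative f' ((f ^^ n) x)) (at ((f ^^ n) x) within (f ^^ n) ` I01)"
    using iterate_maps_to by (intro has_field_derivative_subset[OF deriv[OF iterate_maps_to[OF Suc.prems]]]) blast
  from DERIV_image_chain[OF this Suc.IH[OF Suc.prems]]
  show ?case by (simp add: o_def mult.commute)
qed

lemma D01_iterate: "x \<in> I01 \<Longrightarrow> D01 (f ^^ n) x = (\<Prod>k<n. f' ((f ^^ k) x))"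
  unfolding D01_def using iterate_deriv[of x n]
  by (intro vector_derivative_within_closed_interval)
    (auto simp: has_real_derivative_iff_has_vector_derivative)

lemma D01_iterate_pos: "x \<in> I01 \<Longrightarrow> 0 < D01 (f ^^ n) x"
  by (auto simp: D01_iterate intro!: prod_pos deriv_pos iterate_maps_to
      simp del: atLeastAtMost_iff)

lemma D01_iterate_add:
  assumes "x \<in> I01"
  shows "D01 (f ^^ (m + n)) x = D01 (f ^^ m) ((f ^^ n) x) * D01 (f ^^ n) x"
proof -
  have "(\<Prod>k<n + m. f' ((f ^^ k) x)) = (\<Prod>k<n. f' ((f ^^ k) x)) * (\<Prod>k=n..<n + m. f' ((f ^^ k) x))"
    by (metis atLeast0LessThan le_add1 prod.atLeastLessThan_concat zero_le)
  also have "(\<Prod>k=n..<n + m. f' ((f ^^ k) x)) = (\<Prod>k<m. f' ((f ^^ (k + n)) x))"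
    using prod.shift_bounds_nat_ivl[of "\<lambda>k. f' ((f ^^ k) x)" 0 n m]
    by (simp add: atLeast0LessThan add.commute)
  finally have "(\<Prod>k<m + n. f' ((f ^^ k) x))
      = (\<Prod>k<m. f' ((f ^^ k) ((f ^^ n) x))) * (\<Prod>k<n. f' ((f ^^ k) x))"
    by (simp add: funpow_add add.commute mult.commute)
  then show ?thesis
    unfolding D01_iterate[OF assms] D01_iterate[OF iterate_maps_to[OF assms]] .
qed

lemma deriv_bounds:
  obtains m M where "0 < m" "0 < M" "\<And>x. x \<in> I01 \<Longrightarrow> m \<le> f' x" "\<And>x. x \<in> I01 \<Longrightarrow> f' x \<le> M"
proof -
  obtain a where a: "a \<in> I01" "\<And>x. x \<in> I01 \<Longrightarrow> f' a \<le> f' x"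
    using continuous_attains_inf[OF _ _ cont_deriv] by auto
  obtain b where b: "b \<in> I01" "\<And>x. x \<in> I01 \<Longrightarrow> f' x \<le> f' b"
    using continuous_attains_sup[OF _ _ cont_deriv] by auto
  show ?thesis using that[of "f' a" "f' b"] a b deriv_pos by blast
qed

lemma bdd_above_D01_iterate: "bdd_above ((\<lambda>x. \<bar>D01 (f ^^ n) x\<bar>) ` I01)"
proof -
  obtain m M where M: "\<And>x. x \<in> I01 \<Longrightarrow> f' x \<le> M" using deriv_bounds by metis
  have "\<bar>D01 (f ^^ n) x\<bar> \<le> M ^ n" if x: "x \<in> I01" for x
  proof -
    have "\<bar>D01 (f ^^ n) x\<bar> = (\<Prod>k<n. f' ((f ^^ k) x))"
      using D01_iterate_pos[OF x, of n] by (simp add: D01_iterate[OF x])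
    also have "\<dots> \<le> (\<Prod>k<n. M)"
      by (intro prod_mono conjI M less_imp_le[OF deriv_pos] iterate_maps_to x)
    finally show ?thesis by simp
  qed
  then show ?thesis by (intro bdd_aboveI2)
qed

lemma D01_iterate_le_unif_norm: "x \<in> I01 \<Longrightarrow> D01 (f ^^ n) x \<le> unif_norm (D01 (f ^^ n))"
  using cSUP_upper[OF _ bdd_above_D01_iterate, of x n] unfolding unif_norm_def by simp

lemma unif_norm_D01_iterate_le:
  assumes "\<And>x. x \<in> I01 \<Longrightarrow> D01 (f ^^ n) x \<le> c"
  shows "unif_norm (D01 (f ^^ n)) \<le> c"
  unfolding unif_norm_def
proof (rule cSUP_least)
  fix x :: real assume "x \<in> I01"
  then show "\<bar>D01 (f ^^ n) x\<bar> \<le> c" using assms D01_iterate_pos[of x n] by simp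
qed auto

text \<open>The mean slope of an iterate over the whole interval is 1.\<close>

lemma unif_norm_D01_iterate_ge_1: "1 \<le> unif_norm (D01 (f ^^ n))"
proof -
  have "((f ^^ n) has_derivative (\<lambda>h. (\<Prod>k<n. f' ((f ^^ k) z)) * h)) (at z within I01)"
    if "0 \<le> z" "z \<le> 1" for z
    using iterate_deriv[of z n] that by (simp add: has_field_derivative_def)
  from mvt_simple[of 0 1 "f ^^ n" "\<lambda>z h. (\<Prod>k<n. f' ((f ^^ k) z)) * h", OF _ this]
  obtain z where z: "z \<in> {0<..<1}" "(f ^^ n) 1 - (f ^^ n) 0 = (\<Prod>k<n. f' ((f ^^ k) z))"
    by auto
  moreover have "(f ^^ n) 1 = 1" "(f ^^ n) 0 = 0"
    using f_0 f_1 by (induction n) auto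
  ultimately have "D01 (f ^^ n) z = 1" by (simp add: D01_iterate)
  then show ?thesis using D01_iterate_le_unif_norm[of z n] z by simp
qed

lemma unif_norm_D01_iterate_submult:
  "unif_norm (D01 (f ^^ (m + n))) \<le> unif_norm (D01 (f ^^ m)) * unif_norm (D01 (f ^^ n))"
proof (rule unif_norm_D01_iterate_le)
  fix x :: real assume x: "x \<in> I01"
  show "D01 (f ^^ (m + n)) x \<le> unif_norm (D01 (f ^^ m)) * unif_norm (D01 (f ^^ n))"
    unfolding D01_iterate_add[OF x]
    using x iterate_maps_to[OF x, of n] D01_iterate_pos[of x n] unif_norm_D01_iterate_ge_1[of m]
    by (intro mult_mono D01_iterate_le_unif_norm) auto
qed

lemma iterate_not_fixed:
  assumes "x \<in> I01" "f x \<noteq> x"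
  shows "f ((f ^^ k) x) \<noteq> (f ^^ k) x"
proof (induction k)
  case (Suc k)
  have "(f ^^ k) x \<in> I01" "f ((f ^^ k) x) \<in> I01"
    using assms iterate_maps_to maps_to by blast+
  then show ?case
    using Suc strict_increasing[of "(f ^^ k) x" "f ((f ^^ k) x)"]
      strict_increasing[of "f ((f ^^ k) x)" "(f ^^ k) x"]
    by (auto simp: neq_iff)
qed (use assms in simp)

text \<open>A monotone orbit moves by \<open>x\<^sub>n - x\<^sub>0\<close> in total, at most the length of the interval.\<close>

lemma sum_steps_le_1:
  assumes x: "x \<in> I01"
  shows "(\<Sum>k<n. \<bar>(f ^^ Suc k) x - (f ^^ k) x\<bar>) \<le> 1"
proof -
  have weak: "f a \<le> f b" if "a \<in> I01" "b \<in> I01" "a \<le> b" for a b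
    using that strict_increasing[of a b] by (cases "a = b") auto
  have "(\<Sum>k<n. \<bar>(f ^^ Suc k) x - (f ^^ k) x\<bar>) = \<bar>(f ^^ n) x - (f ^^ 0) x\<bar>"
  proof (cases "x \<le> f x")
    case True
    have inc: "(f ^^ k) x \<le> (f ^^ Suc k) x" for k
    proof (induction k)
      case (Suc k)
      show ?case using weak[OF iterate_maps_to[OF x] iterate_maps_to[OF x] Suc] by simp
    qed (use True in simp)
    then have "(\<Sum>k<n. \<bar>(f ^^ Suc k) x - (f ^^ k) x\<bar>) = (f ^^ n) x - (f ^^ 0) x"
      by (subst sum_lessThan_telescope[symmetric]) (auto intro!: sum.cong)
    then show ?thesis by (smt (verit) sum_nonneg)
  next
    case False
    have dec: "(f ^^ Suc k) x \<le> (f ^^ k) x" for k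
    proof (induction k)
      case (Suc k)
      show ?case using weak[OF iterate_maps_to[OF x] iterate_maps_to[OF x] Suc] by simp
    qed (use False in simp)
    then have "(\<Sum>k<n. \<bar>(f ^^ Suc k) x - (f ^^ k) x\<bar>) = (f ^^ 0) x - (f ^^ n) x"
      by (subst sum_lessThan_telescope'[symmetric]) (auto intro!: sum.cong)
    then show ?thesis by (smt (verit) sum_nonneg)
  qed
  also have "\<dots> \<le> 1" using x iterate_maps_to[OF x, of n] by auto
  finally show ?thesis .
qed

lemma next_step:
  assumes x: "x \<in> I01" "f x \<noteq> x"
  obtains \<xi> where "\<xi> \<in> I01" "\<bar>\<xi> - x\<bar> \<le> \<bar>f x - x\<bar>" "\<bar>f (f x) - f x\<bar> = f' \<xi> * \<bar>f x - x\<bar>"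
proof -
  have fx: "f x \<in> I01" by (rule maps_to[OF x(1)])
  have "\<exists>\<xi>\<in>I01. \<bar>\<xi> - x\<bar> \<le> \<bar>f x - x\<bar> \<and> f (f x) - f x = f' \<xi> * (f x - x)"
  proof (cases "x < f x")
    case True
    obtain \<xi> where "x < \<xi>" "\<xi> < f x" "f (f x) - f x = f' \<xi> * (f x - x)"
      using mean_value[of x "f x"] True x fx by auto
    then show ?thesis using x fx by (intro bexI[of _ \<xi>]) auto
  next
    case False
    then obtain \<xi> where "f x < \<xi>" "\<xi> < x" "f x - f (f x) = f' \<xi> * (x - f x)"
      using mean_value[of "f x" x] x fx by auto
    then show ?thesis using x fx by (intro bexI[of _ \<xi>]) (auto simp: algebra_simps)
  qed
  then obtain \<xi> where "\<xi> \<in> I01" "\<bar>\<xi> - x\<bar> \<le> \<bar>f x - x\<bar>" "f (f x) - f x = f' \<xi> * (f x - x)" by blast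
  then show ?thesis using that[of \<xi>] deriv_pos[of \<xi>] by (simp add: abs_mult)
qed

end

section \<open>Growth when the derivative has a modulus and equals 1 at fixed points\<close>

locale parabolic_interval_diffeo = interval_diffeo +
  fixes \<omega> :: "real \<Rightarrow> real" and K :: real
  assumes \<omega>: "modulus_of_continuity \<omega>" and \<omega>_strict: "strict_mono_on {0..1} \<omega>"
    and K_nonneg: "0 \<le> K"
    and deriv_modulus: "\<And>x y. x \<in> I01 \<Longrightarrow> y \<in> I01 \<Longrightarrow> \<bar>f' x - f' y\<bar> \<le> K * \<omega> \<bar>x - y\<bar>"
    and deriv_fixed: "\<And>p. p \<in> I01 \<Longrightarrow> f p = p \<Longrightarrow> f' p = 1"
begin

lemma deriv_near:
  assumes "x \<in> I01" "y \<in> I01" "\<bar>x - y\<bar> \<le> T" "T \<le> 1"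
  shows "\<bar>f' x - f' y\<bar> \<le> K * \<omega> T"
  using deriv_modulus[OF assms(1,2)] modulus_mono[OF \<omega>, of "\<bar>x - y\<bar>" T] assms K_nonneg
  by (smt (verit) mult_left_mono)

text \<open>If \<open>f' > 1 + s\<close> held within distance \<open>T\<close> of \<open>x\<close>, then \<open>f - id\<close> would reach \<open>0\<close> on the side of
  \<open>x\<close> from which the orbit comes, by the intermediate value theorem or at an end point of the
  interval; but at a fixed point the derivative is 1.\<close>

lemma exists_small_derivative_nearby:
  assumes x: "x \<in> I01" and T: "0 < T" and s: "0 \<le> s" and short: "\<bar>f x - x\<bar> \<le> s * T"
  shows "\<exists>y\<in>I01. \<bar>y - x\<bar> \<le> T \<and> f' y \<le> 1 + s"
proof (rule ccontr)
  assume "\<not> ?thesis"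
  then have large: "1 + s < f' y" if "y \<in> I01" "\<bar>y - x\<bar> \<le> T" for y
    using that by force
  have not_fixed: "f y \<noteq> y" if "y \<in> I01" "\<bar>y - x\<bar> \<le> T" for y
    using large[OF that] deriv_fixed[OF that(1)] s by auto
  have cont: "continuous_on {a..b} (\<lambda>y. f y - y)" if "0 \<le> a" "b \<le> 1" for a b
    using that by (intro continuous_intros continuous_on_subset[OF continuous]) auto
  show False
  proof (cases "x < f x")
    case True
    have xT: "0 \<le> x - T" using not_fixed[of 0] f_0 x T by (cases "x \<le> T") auto
    obtain \<xi> where \<xi>: "x - T < \<xi>" "\<xi> < x" "f x - f (x - T) = f' \<xi> * T"
      using mean_value[of "x - T" x] xT T x by auto
    have "(1 + s) * T < f' \<xi> * T" using large[of \<xi>] \<xi> xT x T by simp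
    then have "f (x - T) - (x - T) \<le> 0"
      using \<xi>(3) short by (simp add: algebra_simps)
    then obtain z where "x - T \<le> z" "z \<le> x" "f z - z = 0"
      using IVT'[where f = "\<lambda>y. f y - y" and a = "x - T" and b = x and y = 0] True T cont[of "x - T" x] xT x by auto
    then show False using not_fixed[of z] xT x by auto
  next
    case False
    have xT: "x + T \<le> 1" using not_fixed[of 1] f_1 x T by (cases "1 \<le> x + T") auto
    obtain \<xi> where \<xi>: "x < \<xi>" "\<xi> < x + T" "f (x + T) - f x = f' \<xi> * T"
      using mean_value[of x "x + T"] xT T x by auto
    have "(1 + s) * T < f' \<xi> * T" using large[of \<xi>] \<xi> xT x T by simp
    then have "0 \<le> f (x + T) - (x + T)"
      using \<xi>(3) short by (simp add: algebra_simps)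
    then obtain z where "x \<le> z" "z \<le> x + T" "f z - z = 0"
      using IVT'[where f = "\<lambda>y. f y - y" and a = x and b = "x + T" and y = 0] False T cont[of x "x + T"] xT x by auto
    then show False using not_fixed[of z] xT x by auto
  qed
qed

text \<open>Two oscillations of \<open>f'\<close> over a distance \<open>T\<close> enter: from the point \<open>y\<close> with small derivative
  to \<open>x\<close>, and from \<open>x\<close> to the mean value point \<open>\<xi>\<close>.\<close>

lemma short_step_growth:
  assumes x: "x \<in> I01" "f x \<noteq> x" and T: "0 < T" "T \<le> 1"
    and s: "0 \<le> s" "s \<le> 1" and short: "\<bar>f x - x\<bar> \<le> s * T"
  shows "\<bar>f (f x) - f x\<bar> \<le> (1 + s + 2 * K * \<omega> T) * \<bar>f x - x\<bar>"
proof -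
  obtain \<xi> where \<xi>: "\<xi> \<in> I01" "\<bar>\<xi> - x\<bar> \<le> \<bar>f x - x\<bar>" "\<bar>f (f x) - f x\<bar> = f' \<xi> * \<bar>f x - x\<bar>"
    using next_step[OF x] .
  obtain y where y: "y \<in> I01" "\<bar>y - x\<bar> \<le> T" "f' y \<le> 1 + s"
    using exists_small_derivative_nearby[OF x(1) T(1) s(1) short] by blast
  have "s * T \<le> T" using s T by (simp add: mult_left_le_one_le)
  then have "\<bar>\<xi> - x\<bar> \<le> T" using \<xi>(2) short by linarith
  then have "\<bar>f' \<xi> - f' x\<bar> \<le> K * \<omega> T" using deriv_near \<xi>(1) x(1) T(2) by blast
  moreover have "\<bar>f' y - f' x\<bar> \<le> K * \<omega> T" using deriv_near y x(1) T(2) by blast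
  ultimately have "f' \<xi> \<le> 1 + s + 2 * K * \<omega> T" using y(3) by linarith
  then show ?thesis unfolding \<xi>(3) by (rule mult_right_mono) simp
qed

text \<open>Passing from \<open>f' \<xi>\<close> to \<open>f' x\<close> adds at most \<open>K \<omega>(\<bar>f x - x\<bar>)\<close>; relative to
  \<open>f' \<xi> \<ge> m\<close> this is a factor of at most \<open>exp (K \<omega>(\<bar>f x - x\<bar>) / m)\<close>.\<close>

lemma step_distortion:
  assumes x: "x \<in> I01" "f x \<noteq> x" and m: "0 < m" "\<And>x. x \<in> I01 \<Longrightarrow> m \<le> f' x"
  shows "f' x * \<bar>f x - x\<bar> \<le> \<bar>f (f x) - f x\<bar> * exp (K / m * \<omega> \<bar>f x - x\<bar>)"
proof -
  let ?J = "\<bar>f x - x\<bar>"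
  obtain \<xi> where \<xi>: "\<xi> \<in> I01" "\<bar>\<xi> - x\<bar> \<le> ?J" "\<bar>f (f x) - f x\<bar> = f' \<xi> * ?J"
    using next_step[OF x] .
  have J1: "?J \<le> 1" using x maps_to[OF x(1)] by auto
  have w: "0 \<le> K * \<omega> ?J" using modulus_nonneg[OF \<omega>] J1 K_nonneg by simp
  have "f' x \<le> f' \<xi> + K * \<omega> ?J" using deriv_near[OF \<xi>(1) x(1) \<xi>(2) J1] by linarith
  also have "\<dots> \<le> f' \<xi> + f' \<xi> / m * (K * \<omega> ?J)"
    using mult_right_mono[OF _ w, of 1 "f' \<xi> / m"] m \<xi>(1) by simp
  also have "\<dots> = f' \<xi> * (1 + K / m * \<omega> ?J)" by (simp add: algebra_simps)
  also have "\<dots> \<le> f' \<xi> * exp (K / m * \<omega> ?J)"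
    using deriv_pos[OF \<xi>(1)] by (intro mult_left_mono exp_ge_add_one_self) auto
  finally have "f' x * ?J \<le> f' \<xi> * exp (K / m * \<omega> ?J) * ?J" by (rule mult_right_mono) simp
  then show ?thesis unfolding \<xi>(3) by (simp add: mult_ac)
qed

lemma derivative_le_step_ratio:
  assumes x: "x \<in> I01" "f x \<noteq> x" and m: "0 < m" "\<And>x. x \<in> I01 \<Longrightarrow> m \<le> f' x"
    and n: "n \<ge> 1"
  shows "D01 (f ^^ n) x * \<bar>f x - x\<bar>
    \<le> \<bar>(f ^^ Suc n) x - (f ^^ n) x\<bar> * exp (2 * K / m * (real n * \<omega> (1 / real n)))"
proof -
  define J where "J k = \<bar>(f ^^ Suc k) x - (f ^^ k) x\<bar>" for k
  have J1: "J k \<le> 1" for k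
    using iterate_maps_to[OF x(1), of k] iterate_maps_to[OF x(1), of "Suc k"]
    unfolding J_def by auto
  have J0: "0 \<le> J k" for k unfolding J_def by simp
  have "(\<Prod>k<i. f' ((f ^^ k) x)) * J 0 \<le> J i * exp (\<Sum>k<i. K / m * \<omega> (J k))" for i
  proof (induction i)
    case (Suc i)
    have xi: "(f ^^ i) x \<in> I01" by (rule iterate_maps_to[OF x(1)])
    have "(\<Prod>k<Suc i. f' ((f ^^ k) x)) * J 0 = f' ((f ^^ i) x) * ((\<Prod>k<i. f' ((f ^^ k) x)) * J 0)"
      by simp
    also have "\<dots> \<le> f' ((f ^^ i) x) * (J i * exp (\<Sum>k<i. K / m * \<omega> (J k)))"
      using Suc deriv_pos[OF xi] by (intro mult_left_mono) auto
    also have "\<dots> = f' ((f ^^ i) x) * J i * exp (\<Sum>k<i. K / m * \<omega> (J k))" by simp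
    also have "\<dots> \<le> J (Suc i) * exp (K / m * \<omega> (J i)) * exp (\<Sum>k<i. K / m * \<omega> (J k))"
      using step_distortion[OF xi iterate_not_fixed[OF x] m]
      by (intro mult_right_mono) (auto simp: J_def)
    finally show ?case by (simp add: exp_add mult_ac)
  qed simp
  from this[of n] have "D01 (f ^^ n) x * J 0 \<le> J n * exp (\<Sum>k<n. K / m * \<omega> (J k))"
    using D01_iterate x(1) by simp
  also have "(\<Sum>k<n. K / m * \<omega> (J k)) \<le> K / m * (2 * real n * \<omega> (1 / real n))"
    unfolding sum_distrib_left[symmetric]
    using sum_modulus_le[OF \<omega> n, of J] J0 J1 sum_steps_le_1[OF x(1), of n] K_nonneg m(1)
    by (intro mult_left_mono) (auto simp: J_def)
  then have "J n * exp (\<Sum>k<n. K / m * \<omega> (J k)) \<le> J n * exp (2 * K / m * (real n * \<omega> (1 / real n)))"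
    using J0[of n] by (intro mult_left_mono) (auto simp: mult_ac)
  finally show ?thesis by (simp add: J_def)
qed

lemma step_ratio_bound:
  assumes x: "x \<in> I01" "f x \<noteq> x" and n: "n \<ge> 1"
    and T: "0 < T" "T \<le> 1" "\<omega> T = 2 / real n"
  shows "\<bar>(f ^^ Suc n) x - (f ^^ n) x\<bar> \<le> real n / T * exp (4 * K + 1) * \<bar>f x - x\<bar>"
proof -
  define J where "J k = \<bar>(f ^^ Suc k) x - (f ^^ k) x\<bar>" for k
  (* The factor 1 + s + 2 K \<omega>(T) of a short step, for s = 1/n and \<omega>(T) = 2/n. *)
  define q where "q = 1 + (4 * K + 1) / real n"
  have n0: "0 < real n" using n by simp
  have q1: "1 \<le> q" unfolding q_def using K_nonneg by simp
  have "J (Suc k) \<le> q * J k" if "J k \<le> T / real n" for k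
    using short_step_growth[OF iterate_maps_to[OF x(1)] iterate_not_fixed[OF x] T(1,2),
        of "1 / real n" k] that n T(3)
    by (simp add: J_def q_def add_divide_distrib algebra_simps)
  moreover have "J k \<le> 1" "0 \<le> J k" for k
    using iterate_maps_to[OF x(1), of k] iterate_maps_to[OF x(1), of "Suc k"]
    unfolding J_def by auto
  moreover have "T / real n \<le> 1" using T n by (simp add: field_simps)
  ultimately have "T / real n * J n \<le> q ^ n * J 0"
    using growth_below_threshold[of "T / real n" q J n] T n0 q1 by simp
  also have "q ^ n \<le> exp (4 * K + 1)"
    using exp_ge_one_plus_x_over_n_power_n[of n "4 * K + 1"] K_nonneg n unfolding q_def by simp
  then have "q ^ n * J 0 \<le> exp (4 * K + 1) * J 0"
    by (rule mult_right_mono) (simp add: J_def)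
  finally have "J n \<le> real n / T * exp (4 * K + 1) * J 0"
    using T n0 by (simp add: field_simps)
  then show ?thesis by (simp add: J_def)
qed

lemma iterate_derivative_bound:
  "\<exists>C. \<forall>n\<ge>1. \<forall>T. 0 < T \<longrightarrow> T \<le> 1 \<longrightarrow> \<omega> T = 2 / real n \<longrightarrow>
     unif_norm (D01 (f ^^ n)) \<le> real n / T * exp (C * real n * \<omega> (1 / real n))"
proof -
  obtain m where m: "0 < m" "\<And>x. x \<in> I01 \<Longrightarrow> m \<le> f' x" using deriv_bounds by metis
  have \<omega>1: "0 < \<omega> 1"
    using strict_mono_onD[OF \<omega>_strict, of 0 1] \<omega> unfolding modulus_of_continuity_def by simp
  define C where "C = (4 * K + 1) / \<omega> 1 + 2 * K / m"
  have "D01 (f ^^ n) x \<le> real n / T * exp (C * real n * \<omega> (1 / real n))"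
    if n: "n \<ge> 1" and T: "0 < T" "T \<le> 1" "\<omega> T = 2 / real n" and x: "x \<in> I01" for n T x
  proof (cases "f x = x")
    case True
    have "(f ^^ k) x = x" for k using True by (induction k) auto
    then have "D01 (f ^^ n) x = 1" using D01_iterate[OF x] deriv_fixed[OF x True] by simp
    moreover have "1 * 1 \<le> real n / T * exp (C * real n * \<omega> (1 / real n))"
    proof (rule mult_mono)
      show "1 \<le> real n / T" using n T by (simp add: field_simps)
      show "1 \<le> exp (C * real n * \<omega> (1 / real n))"
        using \<omega>1 m K_nonneg modulus_nonneg[OF \<omega>, of "1 / real n"] n unfolding C_def by simp
    qed (use T in auto)
    ultimately show ?thesis by simp
  next
    case False
    let ?w = "real n * \<omega> (1 / real n)"
    (* The constant 4 K + 1 is absorbed: n \<omega>(1/n) is bounded below by \<omega>(1). *)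
    have "\<omega> 1 \<le> ?w" using modulus_le_multiple[OF \<omega>, of "1 / real n" 1 n] n by simp
    then have "(4 * K + 1) / \<omega> 1 * \<omega> 1 \<le> (4 * K + 1) / \<omega> 1 * ?w"
      using K_nonneg \<omega>1 by (intro mult_left_mono) auto
    then have "4 * K + 1 \<le> (4 * K + 1) / \<omega> 1 * ?w" using \<omega>1 by simp
    then have "4 * K + 1 + 2 * K / m * ?w \<le> C * ?w" unfolding C_def distrib_right by simp
    then have exponent: "4 * K + 1 + 2 * K / m * ?w \<le> C * real n * \<omega> (1 / real n)"
      by (simp add: mult.assoc)
    have "D01 (f ^^ n) x * \<bar>f x - x\<bar>
        \<le> \<bar>(f ^^ Suc n) x - (f ^^ n) x\<bar> * exp (2 * K / m * ?w)"
      by (rule derivative_le_step_ratio[OF x False m n])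
    also have "\<dots> \<le> real n / T * exp (4 * K + 1) * \<bar>f x - x\<bar> * exp (2 * K / m * ?w)"
      using step_ratio_bound[OF x False n T] by (intro mult_right_mono) auto
    also have "\<dots> = real n / T * exp (4 * K + 1 + 2 * K / m * ?w) * \<bar>f x - x\<bar>"
      by (simp add: exp_add)
    finally have "D01 (f ^^ n) x \<le> real n / T * exp (4 * K + 1 + 2 * K / m * ?w)"
      by (rule mult_right_le_imp_le) (use False in simp)
    also have "\<dots> \<le> real n / T * exp (C * real n * \<omega> (1 / real n))"
      using exponent T by (intro mult_left_mono) auto
    finally show ?thesis .
  qed
  then show ?thesis by (intro exI[of _ C] allI impI unif_norm_D01_iterate_le) auto
qed

end

section \<open>A diffeomorphism and its inverse\<close>

lemma inv01_left: "f \<in> Diff0 \<Longrightarrow> x \<in> I01 \<Longrightarrow> inv01 f (f x) = x"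
  unfolding Diff0_def inv01_def bij_betw_def by (auto intro: inv_into_f_f)

lemma inv01_right: "f \<in> Diff0 \<Longrightarrow> y \<in> I01 \<Longrightarrow> f (inv01 f y) = y \<and> inv01 f y \<in> I01"
  unfolding Diff0_def inv01_def bij_betw_def
  by (metis (mono_tags, lifting) f_inv_into_f inv_into_into mem_Collect_eq)

lemma C1_01_deriv:
  "C1_01 f \<Longrightarrow> x \<in> I01 \<Longrightarrow> (f has_real_derivative D01 f x) (at x within I01)"
  unfolding C1_01_def D01_def has_real_derivative_iff_has_vector_derivative
  by (simp add: vector_derivative_works)

lemma D01_inv01_mult:
  assumes f: "f \<in> Diff0" and x: "x \<in> I01"
  shows "D01 (inv01 f) (f x) * D01 f x = 1"
proof -
  have C1: "C1_01 f" "C1_01 (inv01 f)" and im: "f ` I01 = I01"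
    using f unfolding Diff0_def bij_betw_def by auto
  have "f x \<in> I01" using im x by blast
  then have "(inv01 f has_real_derivative D01 (inv01 f) (f x)) (at (f x) within f ` I01)"
    using C1_01_deriv[OF C1(2)] im by simp
  then have "(inv01 f \<circ> f has_real_derivative D01 (inv01 f) (f x) * D01 f x) (at x within I01)"
    by (rule DERIV_image_chain) (rule C1_01_deriv[OF C1(1) x])
  then have "((\<lambda>x. x) has_real_derivative D01 (inv01 f) (f x) * D01 f x) (at x within I01)"
    by (rule has_field_derivative_transform_within[where d = 1])
      (use x inv01_left[OF f] in auto)
  then have "vector_derivative (\<lambda>x. x) (at x within I01) = D01 (inv01 f) (f x) * D01 f x"
    using x by (intro vector_derivative_within_closed_interval)
      (auto simp: has_real_derivative_iff_has_vector_derivative)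
  moreover have "vector_derivative (\<lambda>x. x) (at x within I01) = 1"
    using x by (intro vector_derivative_within_closed_interval)
      (auto simp: has_vector_derivative_id)
  ultimately show ?thesis by simp
qed

text \<open>The derivative has no zero, having an inverse, and by the mean value theorem it equals 1
  somewhere; so it cannot change sign.\<close>

lemma Diff0_deriv_pos:
  assumes f: "f \<in> Diff0" and x: "x \<in> I01"
  shows "0 < D01 f x"
proof (rule ccontr)
  assume neg: "\<not> 0 < D01 f x"
  have C1: "C1_01 f" and ends: "f 0 = 0" "f 1 = 1" using f unfolding Diff0_def by auto
  have cont: "continuous_on I01 (D01 f)" using C1 unfolding C1_01_def by simp
  have "(f has_derivative (\<lambda>h. D01 f z * h)) (at z within I01)" if "0 \<le> z" "z \<le> 1" for z
    using C1_01_deriv[OF C1, of z] that by (simp add: has_field_derivative_def)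
  from mvt_simple[of 0 1 f "\<lambda>z h. D01 f z * h", OF _ this]
  obtain z where z: "z \<in> {0<..<1}" "D01 f z = 1" using ends by auto
  have "connected (D01 f ` I01)" by (rule connected_continuous_image[OF cont]) simp
  moreover have "D01 f x \<in> D01 f ` I01" "1 \<in> D01 f ` I01"
    using x z by (auto intro!: image_eqI[of _ _ z])
  ultimately have "0 \<in> D01 f ` I01" using neg connectedD_interval[of "D01 f ` I01" "D01 f x" 1 0] by simp
  then obtain y where "y \<in> I01" "D01 f y = 0" by force
  then show False using D01_inv01_mult[OF f, of y] by simp
qed

lemma interval_diffeo_Diff0:
  assumes "f \<in> Diff0"
  shows "interval_diffeo f (D01 f)"
proof
  have "C1_01 f" using assms unfolding Diff0_def by simp
  then show "continuous_on I01 (D01 f)" unfolding C1_01_def by simp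
qed (use assms C1_01_deriv Diff0_deriv_pos in \<open>auto simp: Diff0_def\<close>)

lemma D01_inv01:
  assumes "f \<in> Diff0" "y \<in> I01"
  shows "D01 (inv01 f) y = 1 / D01 f (inv01 f y)"
proof -
  have "D01 (inv01 f) y * D01 f (inv01 f y) = 1"
    using D01_inv01_mult[OF assms(1), of "inv01 f y"] inv01_right[OF assms] by simp
  moreover have "0 < D01 f (inv01 f y)" using Diff0_deriv_pos inv01_right assms by blast
  ultimately show ?thesis by (simp add: field_simps)
qed

lemma interval_diffeo_inv01:
  assumes f: "f \<in> Diff0"
  shows "interval_diffeo (inv01 f) (D01 (inv01 f))"
proof
  have C1: "C1_01 (inv01 f)" and ends: "f 0 = 0" "f 1 = 1" using f unfolding Diff0_def by auto
  show "inv01 f 0 = 0" "inv01 f 1 = 1"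
    using inv01_left[OF f, of 0] inv01_left[OF f, of 1] ends by auto
  show "continuous_on I01 (D01 (inv01 f))" using C1 unfolding C1_01_def by simp
  show "(inv01 f has_real_derivative D01 (inv01 f) x) (at x within I01)" if "x \<in> I01" for x
    by (rule C1_01_deriv[OF C1 that])
  show "0 < D01 (inv01 f) x" if "x \<in> I01" for x
    using D01_inv01[OF f that] Diff0_deriv_pos[OF f] inv01_right[OF f that] by simp
qed

section \<open>The growth rate and fixed points\<close>

lemma growth_seq_ge_1: "f \<in> Diff0 \<Longrightarrow> 1 \<le> growth_seq n f"
  unfolding growth_seq_def
  using interval_diffeo.unif_norm_D01_iterate_ge_1[OF interval_diffeo_Diff0, of f n] by linarith

lemma growth_seq_submult:
  assumes f: "f \<in> Diff0"
  shows "growth_seq (m + n) f \<le> growth_seq m f * growth_seq n f"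
proof -
  interpret F: interval_diffeo f "D01 f" by (rule interval_diffeo_Diff0[OF f])
  interpret G: interval_diffeo "inv01 f" "D01 (inv01 f)" by (rule interval_diffeo_inv01[OF f])
  note ge_1 = F.unif_norm_D01_iterate_ge_1[of m] F.unif_norm_D01_iterate_ge_1[of n]
    G.unif_norm_D01_iterate_ge_1[of m] G.unif_norm_D01_iterate_ge_1[of n]
  have "unif_norm (D01 (f ^^ m)) * unif_norm (D01 (f ^^ n)) \<le> growth_seq m f * growth_seq n f"
    "unif_norm (D01 (inv01 f ^^ m)) * unif_norm (D01 (inv01 f ^^ n)) \<le> growth_seq m f * growth_seq n f"
    unfolding growth_seq_def using ge_1 by (auto intro!: mult_mono)
  then show ?thesis
    using F.unif_norm_D01_iterate_submult[of m n] G.unif_norm_D01_iterate_submult[of m n]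
    unfolding growth_seq_def[of "m + n"] by linarith
qed

lemma growth_rate_LIMSEQ:
  assumes f: "f \<in> Diff0"
  shows "(\<lambda>n. root n (growth_seq n f)) \<longlonglongrightarrow> growth_rate f"
proof -
  let ?u = "\<lambda>n. ln (growth_seq n f)"
  have pos: "0 < growth_seq n f" for n using growth_seq_ge_1[OF f, of n] by linarith
  have "?u (m + n) \<le> ?u m + ?u n" for m n
    using growth_seq_submult[OF f, of m n] pos
    by (metis ln_le_cancel_iff ln_mult_pos mult_pos_pos)
  moreover have "0 \<le> ?u n" for n using growth_seq_ge_1[OF f] by simp
  ultimately have "convergent (\<lambda>n. ?u n / real n)" by (rule fekete_convergent)
  then obtain l where "(\<lambda>n. ?u n / real n) \<longlonglongrightarrow> l" unfolding convergent_def by blast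
  then have "(\<lambda>n. exp (?u n / real n)) \<longlonglongrightarrow> exp l" by (rule tendsto_exp)
  moreover have "eventually (\<lambda>n. exp (?u n / real n) = root n (growth_seq n f)) sequentially"
    using eventually_gt_at_top[of 0]
  proof eventually_elim
    case (elim n)
    then show ?case using pos[of n] by (simp add: root_powr_inverse powr_def)
  qed
  ultimately have "(\<lambda>n. root n (growth_seq n f)) \<longlonglongrightarrow> exp l"
    by (rule Lim_transform_eventually)
  then show ?thesis unfolding growth_rate_def by (simp add: limI)
qed

lemma interval_diffeo_fixed_growth:
  assumes "interval_diffeo f f'" "p \<in> I01" "f p = p"
  shows "f' p ^ n \<le> unif_norm (D01 (f ^^ n))"
proof -
  interpret interval_diffeo f f' by fact
  have "(f ^^ k) p = p" for k using assms(3) by (induction k) auto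
  then show ?thesis using D01_iterate_le_unif_norm[OF assms(2), of n] D01_iterate[OF assms(2), of n]
    by simp
qed

text \<open>At a fixed point \<open>p\<close> the iterates satisfy \<open>(f\<^sup>n)'(p) = f'(p)\<^sup>n\<close>, so \<open>\<gamma>(f)\<close> is at least
  \<open>f'(p)\<close> and at least \<open>1 / f'(p)\<close>.\<close>

lemma derivative_at_fixed_point:
  assumes f: "f \<in> Diff0" and \<gamma>: "growth_rate f = 1" and p: "p \<in> I01" "f p = p"
  shows "D01 f p = 1"
proof -
  have le_1: "\<mu> \<le> 1" if \<mu>: "0 < \<mu>" "\<And>n. \<mu> ^ n \<le> growth_seq n f" for \<mu>
  proof (rule LIMSEQ_le_const)
    show "(\<lambda>n. root n (growth_seq n f)) \<longlonglongrightarrow> 1" using growth_rate_LIMSEQ[OF f] \<gamma> by simp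
    have "\<mu> \<le> root n (growth_seq n f)" if "n \<ge> 1" for n
      using real_root_le_mono[OF _ \<mu>(2)[of n], of n] real_root_power_cancel[of n \<mu>] \<mu>(1) that by simp
    then show "\<exists>N. \<forall>n\<ge>N. \<mu> \<le> root n (growth_seq n f)" by blast
  qed
  have inv_p: "inv01 f p = p" using inv01_left[OF f p(1)] p(2) by simp
  have pos: "0 < D01 f p" by (rule Diff0_deriv_pos[OF f p(1)])
  have "D01 f p \<le> 1"
    using interval_diffeo_fixed_growth[OF interval_diffeo_Diff0[OF f] p] pos
    by (intro le_1) (auto simp: growth_seq_def le_max_iff_disj)
  moreover have "1 / D01 f p \<le> 1"
    using interval_diffeo_fixed_growth[OF interval_diffeo_inv01[OF f] p(1) inv_p] pos
      D01_inv01[OF f p(1)] inv_p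
    by (intro le_1) (auto simp: growth_seq_def le_max_iff_disj)
  ultimately show ?thesis using pos by (simp add: field_simps)
qed

section \<open>The growth bound\<close>

lemma Diff0_mod_deriv_modulus:
  assumes "f \<in> Diff0_mod \<omega>" "modulus_of_continuity \<omega>"
  obtains K where "0 \<le> K" "\<And>x y. x \<in> I01 \<Longrightarrow> y \<in> I01 \<Longrightarrow> \<bar>D01 f x - D01 f y\<bar> \<le> K * \<omega> \<bar>x - y\<bar>"
proof -
  obtain K where f: "f \<in> Diff0" and K: "\<And>\<delta>. \<delta> \<in> I01 \<Longrightarrow> osc_modulus (D01 f) \<delta> \<le> K * \<omega> \<delta>"
    using assms(1) unfolding Diff0_mod_def by blast
  interpret interval_diffeo f "D01 f" by (rule interval_diffeo_Diff0[OF f])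
  obtain M where M: "\<And>x. x \<in> I01 \<Longrightarrow> D01 f x \<le> M" using deriv_bounds by metis
  have "\<bar>D01 f x - D01 f y\<bar> \<le> max K 0 * \<omega> \<bar>x - y\<bar>" if xy: "x \<in> I01" "y \<in> I01" for x y
  proof -
    have \<delta>: "\<bar>x - y\<bar> \<in> I01" using xy by auto
    have "\<bar>D01 f x - D01 f y\<bar> \<le> osc_modulus (D01 f) \<bar>x - y\<bar>"
      unfolding osc_modulus_def
    proof (rule cSup_upper)
      show "bdd_above {\<bar>D01 f u - D01 f v\<bar> |u v. u \<in> I01 \<and> v \<in> I01 \<and> \<bar>u - v\<bar> \<le> \<bar>x - y\<bar>}"
      proof (rule bdd_aboveI[of _ M], clarify)
        fix u v :: real assume "u \<in> I01" "v \<in> I01"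
        then show "\<bar>D01 f u - D01 f v\<bar> \<le> M" using M[of u] M[of v] deriv_pos[of u] deriv_pos[of v] by linarith
      qed
    qed (use xy in blast)
    also have "\<dots> \<le> K * \<omega> \<bar>x - y\<bar>" by (rule K[OF \<delta>])
    also have "\<dots> \<le> max K 0 * \<omega> \<bar>x - y\<bar>"
      using modulus_nonneg[OF assms(2)] \<delta> by (intro mult_right_mono) auto
    finally show ?thesis .
  qed
  then show ?thesis using that[of "max K 0"] by auto
qed

text \<open>The derivative of the inverse is \<open>1 / f'\<close> composed with the inverse, which is Lipschitz with
  constant \<open>1/m\<close> where \<open>m\<close> is the minimum of \<open>f'\<close>; subadditivity of \<open>\<omega>\<close> absorbs the Lipschitz
  constant.\<close>

lemma inv01_deriv_modulus:
  assumes f: "f \<in> Diff0" and \<omega>: "modulus_of_continuity \<omega>"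
    and K: "0 \<le> K" "\<And>x y. x \<in> I01 \<Longrightarrow> y \<in> I01 \<Longrightarrow> \<bar>D01 f x - D01 f y\<bar> \<le> K * \<omega> \<bar>x - y\<bar>"
  obtains K' where "0 \<le> K'"
    "\<And>x y. x \<in> I01 \<Longrightarrow> y \<in> I01 \<Longrightarrow> \<bar>D01 (inv01 f) x - D01 (inv01 f) y\<bar> \<le> K' * \<omega> \<bar>x - y\<bar>"
proof -
  let ?g = "inv01 f"
  interpret F: interval_diffeo f "D01 f" by (rule interval_diffeo_Diff0[OF f])
  interpret G: interval_diffeo ?g "D01 ?g" by (rule interval_diffeo_inv01[OF f])
  obtain m where m: "0 < m" "\<And>x. x \<in> I01 \<Longrightarrow> m \<le> D01 f x" using F.deriv_bounds by metis
  define N where "N = nat \<lceil>1 / m\<rceil>"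
  have N: "1 / m \<le> real N" unfolding N_def by linarith
  have expand: "m * (y - x) \<le> f y - f x" if "x \<in> I01" "y \<in> I01" "x \<le> y" for x y
  proof (cases "x = y")
    case False
    then have "0 \<le> x" "x < y" "y \<le> 1" using that by auto
    then obtain \<xi> where \<xi>: "x < \<xi>" "\<xi> < y" "f y - f x = D01 f \<xi> * (y - x)"
      by (rule F.mean_value)
    then show ?thesis using m(2)[of \<xi>] that by (auto intro: mult_right_mono)
  qed simp
  have "\<bar>D01 ?g x - D01 ?g y\<bar> \<le> K / m\<^sup>2 * real N * \<omega> \<bar>x - y\<bar>" if x: "x \<in> I01" and y: "y \<in> I01" for x y
  proof -
    let ?a = "?g x" and ?b = "?g y"
    have ab: "?a \<in> I01" "?b \<in> I01" "f ?a = x" "f ?b = y" using inv01_right[OF f] x y by auto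
    have "m * \<bar>?a - ?b\<bar> \<le> \<bar>x - y\<bar>"
      using expand[OF ab(1,2)] expand[OF ab(2,1)] ab(3,4) by (cases "?a \<le> ?b") auto
    then have "\<bar>?a - ?b\<bar> \<le> 1 / m * \<bar>x - y\<bar>" using m(1) by (simp add: field_simps)
    also have "\<dots> \<le> real N * \<bar>x - y\<bar>" by (rule mult_right_mono[OF N]) simp
    finally have "\<omega> \<bar>?a - ?b\<bar> \<le> real N * \<omega> \<bar>x - y\<bar>"
      using x y ab(1,2) by (intro modulus_le_multiple[OF \<omega>]) auto
    then have "\<bar>D01 f ?a - D01 f ?b\<bar> \<le> K * (real N * \<omega> \<bar>x - y\<bar>)"
      using K(2)[OF ab(1,2)] mult_left_mono[OF _ K(1)] order_trans by blast
    have d: "m \<le> D01 f ?a" "m \<le> D01 f ?b" using m(2) ab by auto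
    have "\<bar>D01 ?g x - D01 ?g y\<bar> = \<bar>D01 f ?b - D01 f ?a\<bar> / (D01 f ?a * D01 f ?b)"
    proof -
      have "1 / D01 f ?a - 1 / D01 f ?b = (D01 f ?b - D01 f ?a) / (D01 f ?a * D01 f ?b)"
        using d m(1) by (simp add: field_simps)
      then show ?thesis using d m(1) D01_inv01[OF f x] D01_inv01[OF f y] by (simp add: abs_mult)
    qed
    also have "\<dots> \<le> (K * (real N * \<omega> \<bar>x - y\<bar>)) / (m * m)"
    proof (rule frac_le)
      show "\<bar>D01 f ?b - D01 f ?a\<bar> \<le> K * (real N * \<omega> \<bar>x - y\<bar>)"
        using \<open>\<bar>D01 f ?a - D01 f ?b\<bar> \<le> K * (real N * \<omega> \<bar>x - y\<bar>)\<close> by (simp add: abs_minus_commute)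
      then show "0 \<le> K * (real N * \<omega> \<bar>x - y\<bar>)" by linarith
      show "m * m \<le> D01 f ?a * D01 f ?b" using d m(1) by (intro mult_mono) auto
    qed (use m in auto)
    finally show ?thesis by (simp add: power2_eq_square mult_ac)
  qed
  then show ?thesis using that[of "K / m\<^sup>2 * real N"] K(1) by simp
qed

theorem theorem4:
  fixes \<omega> :: "real \<Rightarrow> real"
  assumes "modulus_of_continuity \<omega>"
    and "strict_mono_on {0..1} \<omega>"
  shows "\<forall>f \<in> Diff0_mod \<omega>. growth_rate f = 1 \<longrightarrow>
    (\<exists>C::real. \<forall>n::nat. n \<ge> 1 \<longrightarrow> 2 / real n \<in> \<omega> ` {0..1} \<longrightarrow>
       ln (growth_seq n f) \<le> ln (real n / the_inv_into {0..1} \<omega> (2 / real n))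
                              + C * real n * \<omega> (1 / real n))"
proof (intro ballI impI)
  fix f assume fm: "f \<in> Diff0_mod \<omega>" and \<gamma>: "growth_rate f = 1"
  have f: "f \<in> Diff0" using fm unfolding Diff0_mod_def by simp
  obtain K where K: "0 \<le> K"
    "\<And>x y. x \<in> I01 \<Longrightarrow> y \<in> I01 \<Longrightarrow> \<bar>D01 f x - D01 f y\<bar> \<le> K * \<omega> \<bar>x - y\<bar>"
    using Diff0_mod_deriv_modulus[OF fm assms(1)] by metis
  obtain K' where K': "0 \<le> K'"
    "\<And>x y. x \<in> I01 \<Longrightarrow> y \<in> I01 \<Longrightarrow> \<bar>D01 (inv01 f) x - D01 (inv01 f) y\<bar> \<le> K' * \<omega> \<bar>x - y\<bar>"
    using inv01_deriv_modulus[OF f assms(1) K(1)] K(2) by metis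
  have inv_fixed: "D01 (inv01 f) p = 1" if p: "p \<in> I01" "inv01 f p = p" for p
  proof -
    have "f p = p" using inv01_right[OF f p(1)] p(2) by simp
    then show ?thesis using D01_inv01[OF f p(1)] derivative_at_fixed_point[OF f \<gamma> p(1)] p(2) by simp
  qed
  interpret F: parabolic_interval_diffeo f "D01 f" \<omega> K
    using interval_diffeo_Diff0[OF f] assms K derivative_at_fixed_point[OF f \<gamma>]
    by (simp add: parabolic_interval_diffeo_def parabolic_interval_diffeo_axioms_def
        del: atLeastAtMost_iff)
  interpret G: parabolic_interval_diffeo "inv01 f" "D01 (inv01 f)" \<omega> K'
    using interval_diffeo_inv01[OF f] assms K' inv_fixed
    by (simp add: parabolic_interval_diffeo_def parabolic_interval_diffeo_axioms_def
        del: atLeastAtMost_iff)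
  obtain C1 where C1: "\<And>n T. n \<ge> 1 \<Longrightarrow> 0 < T \<Longrightarrow> T \<le> 1 \<Longrightarrow> \<omega> T = 2 / real n \<Longrightarrow>
      unif_norm (D01 (f ^^ n)) \<le> real n / T * exp (C1 * real n * \<omega> (1 / real n))"
    using F.iterate_derivative_bound by blast
  obtain C2 where C2: "\<And>n T. n \<ge> 1 \<Longrightarrow> 0 < T \<Longrightarrow> T \<le> 1 \<Longrightarrow> \<omega> T = 2 / real n \<Longrightarrow>
      unif_norm (D01 (inv01 f ^^ n)) \<le> real n / T * exp (C2 * real n * \<omega> (1 / real n))"
    using G.iterate_derivative_bound by blast
  define C where "C = max C1 C2"
  show "\<exists>C::real. \<forall>n::nat. n \<ge> 1 \<longrightarrow> 2 / real n \<in> \<omega> ` {0..1} \<longrightarrow>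
       ln (growth_seq n f) \<le> ln (real n / the_inv_into {0..1} \<omega> (2 / real n))
                              + C * real n * \<omega> (1 / real n)"
  proof (intro exI[of _ C] allI impI)
    fix n :: nat assume n: "n \<ge> 1" and range: "2 / real n \<in> \<omega> ` {0..1}"
    define T where "T = the_inv_into {0..1} \<omega> (2 / real n)"
    have inj: "inj_on \<omega> {0..1}" by (rule strict_mono_on_imp_inj_on[OF assms(2)])
    have T: "T \<in> {0..1}" "\<omega> T = 2 / real n"
      unfolding T_def
      using the_inv_into_into[OF inj range order_refl] f_the_inv_into_f[OF inj range] .
    have "T \<noteq> 0" using T(2) n assms(1) unfolding modulus_of_continuity_def by auto
    then have T01: "0 < T" "T \<le> 1" using T(1) by auto
    have w: "0 \<le> real n * \<omega> (1 / real n)" using modulus_nonneg[OF assms(1)] n by simp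
    have mono: "real n / T * exp (c * real n * \<omega> (1 / real n))
        \<le> real n / T * exp (C * real n * \<omega> (1 / real n))" if "c \<le> C" for c
      using mult_right_mono[OF that w] T01 by (intro mult_left_mono) (auto simp: mult.assoc)
    have "growth_seq n f \<le> real n / T * exp (C * real n * \<omega> (1 / real n))"
      unfolding growth_seq_def
      using order_trans[OF C1[OF n T01 T(2)] mono[of C1]] order_trans[OF C2[OF n T01 T(2)] mono[of C2]]
      by (simp add: C_def)
    then have "ln (growth_seq n f) \<le> ln (real n / T * exp (C * real n * \<omega> (1 / real n)))"
      using growth_seq_ge_1[OF f, of n] by (intro ln_mono) linarith+
    also have "\<dots> = ln (real n / T) + C * real n * \<omega> (1 / real n)"
      using T01 n by (subst ln_mult_pos) auto
    finally show "ln (growth_seq n f) \<le> ln (real n / the_inv_into {0..1} \<omega> (2 / real n))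
        + C * real n * \<omega> (1 / real n)" unfolding T_def .
  qed
qed

end
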